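(* Let $\sigma$ be a list of three complex numbers such that $\rho(\sigma)>0$ and $\rho(\sigma)$ occurs in $\sigma$ with multiplicity exactly $1$. If $\sigma$ is not of the form $\{a,b,-a\}$ with $a>b>0$, then $\sigma$ is $\mathcal{IR}$ if and only if $\sigma$ is $\mathcal{R}$. If $\sigma=\{a,b,-a\}$ with $a>b>0$, then $\sigma$ is not $\mathcal{IR}$. In particular, if the sum of the elements of $\sigma$ is $0$, then $\sigma$ is $\mathcal{IR}$ if and only if $\sigma$ is $\mathcal{R}$.
   Context: For a list $\sigma$ of $n$ complex numbers (repeats allowed), $\rho(\sigma)$ denotes the largest absolute value of an element of $\sigma$. The list $\sigma$ is realizable ($\mathcal{R}$) if there is an $n\times n$ entrywise nonnegative matrix whose list of eigenvalues, with multiplicities, is $\sigma$; it is irreducibly realizable ($\mathcal{IR}$) if such a matrix can be chosen irreducible. A square matrix is irreducible if it is not similar by a permutation matrix to a nontrivially block triangular matrix (equivalently, its digraph is strongly connected). *)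

theory Defs
  imports
    "HOL-Library.Multiset"
    "HOL-Combinatorics.Permutations"
    "HOL-Computational_Algebra.Polynomial"
    "Jordan_Normal_Form.Char_Poly"
begin

(* Lists of complex numbers are unordered here (they are written with braces and compared with
   lists of eigenvalues), so they are represented by multisets. *)

(* Only meaningful for nonempty lists: Max {} is unspecified. *)
definition max_modulus :: "complex multiset \<Rightarrow> real" where
  "max_modulus \<sigma> = Max (cmod ` set_mset \<sigma>)"

(* Eigenvalues over the complex numbers, with algebraic multiplicity. *)
definition eigenvalue_mset :: "real mat \<Rightarrow> complex multiset" where
  "eigenvalue_mset A = proots (char_poly (map_mat complex_of_real A))"

definition nonneg_mat :: "real mat \<Rightarrow> bool" where
  "nonneg_mat A \<longleftrightarrow> (\<forall>i < dim_row A. \<forall>j < dim_col A. 0 \<le> A $$ (i, j))"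

definition permutation_mat :: "nat \<Rightarrow> 'a :: semiring_1 mat \<Rightarrow> bool" where
  "permutation_mat n P \<longleftrightarrow>
     (\<exists>p. p permutes {..<n} \<and> P = mat n n (\<lambda>(i, j). if i = p j then 1 else 0))"

(* Two nonempty square diagonal blocks suffice: a triangular arrangement with more blocks
   becomes one with two by merging blocks. Lower block triangular matrices are turned into upper
   ones by the reversing permutation, so irreducibility does not depend on this choice. *)
definition block_triangular_mat :: "'a :: zero mat \<Rightarrow> bool" where
  "block_triangular_mat A \<longleftrightarrow>
     (\<exists>k m A11 A12 A22. 0 < k \<and> 0 < m \<and>
        A11 \<in> carrier_mat k k \<and> A12 \<in> carrier_mat k m \<and> A22 \<in> carrier_mat m m \<and>
        A = four_block_mat A11 A12 (0\<^sub>m m k) A22)"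

(* For a permutation matrix P the inverse is the transpose. *)
definition irreducible_mat :: "'a :: semiring_1 mat \<Rightarrow> bool" where
  "irreducible_mat A \<longleftrightarrow> square_mat A \<and>
     \<not> (\<exists>P B. permutation_mat (dim_row A) P \<and>
              similar_mat_wit A B P (transpose_mat P) \<and> block_triangular_mat B)"

definition realizable :: "complex multiset \<Rightarrow> bool" where
  "realizable \<sigma> \<longleftrightarrow>
     (\<exists>A \<in> carrier_mat (size \<sigma>) (size \<sigma>). nonneg_mat A \<and> eigenvalue_mset A = \<sigma>)"

definition irreducibly_realizable :: "complex multiset \<Rightarrow> bool" where
  "irreducibly_realizable \<sigma> \<longleftrightarrow>
     (\<exists>A \<in> carrier_mat (size \<sigma>) (size \<sigma>).
        nonneg_mat A \<and> irreducible_mat A \<and> eigenvalue_mset A = \<sigma>)"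

end

theory Submission
  imports Defs "HOL-Computational_Algebra.Fundamental_Theorem_Algebra"
begin

text \<open>Irreducibility of a 3-by-3 matrix says that no row and no column vanishes off the diagonal.
  A reducible nonnegative matrix has only real eigenvalues, being the union of the spectra of blocks
  of sizes 1 and 2 whose off-diagonal products are nonnegative; hence a realizable list containing a
  nonreal number is realized by an irreducible matrix only. A real list \<open>x > y \<ge> z\<close> is realized by an
  explicit irreducible matrix: a scalar matrix plus a constant one, a companion matrix, or a tridiagonal
  one.

  For \<open>{a, b, -a}\<close> the second and third coefficients of the characteristic polynomial force
  \<open>tr A \<cdot> E\<^sub>2 = det A\<close>, where \<open>E\<^sub>2\<close> is the sum of the principal 2-by-2 minors. In terms of the
  diagonal entries \<open>p, q, r\<close>, the 2-cycle products \<open>u, v, w\<close> and the 3-cycle products \<open>s, t\<close> this is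
  \<open>(p + q)(q + r)(p + r) = u(p + q) + v(q + r) + w(p + r) + s + t\<close>, while \<open>b < a\<close> makes
  \<open>u + v + w\<close> larger than \<open>(p + q + r)\<^sup>2\<close>. The smallest of the three pairwise sums must then
  vanish, which leaves a single nonzero 2-cycle and no irreducibility.\<close>

section \<open>Permutation similarity and a combinatorial criterion for irreducibility\<close>

lemma index_permutation_conj:
  fixes A :: "'a :: comm_ring_1 mat"
  assumes p: "p permutes {..<n}" and A: "A \<in> carrier_mat n n" and k: "k < n" and l: "l < n"
    and P: "P = mat n n (\<lambda>(i, j). if i = p j then 1 else 0)"
  shows "(transpose_mat P * A * P) $$ (k, l) = A $$ (p k, p l)"
proof -
  have pk: "p k < n" "p l < n"
    using permutes_in_image[OF p] k l by auto
  have row: "(transpose_mat P * A) $$ (k, j) = A $$ (p k, j)" if "j < n" for j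
    using that A k pk
    by (simp add: P scalar_prod_def if_distrib[of "\<lambda>x. x * _"] sum.delta cong: if_cong)
  define M where "M = transpose_mat P * A"
  have "M \<in> carrier_mat n n" 
    using A by (intro carrier_matI) (auto simp: M_def P)
  then have "(M * P) $$ (k, l) = (\<Sum>j = 0..<n. M $$ (k, j) * (if j = p l then 1 else 0))"
    using k l by (simp add: P scalar_prod_def)
  also have "\<dots> = M $$ (k, p l)"
    using pk by (simp add: if_distrib[of "\<lambda>x. _ * x"] sum.delta cong: if_cong)
  finally show ?thesis using row[OF pk(2)] by (simp add: M_def)
qed

lemma permutation_mat_orthogonal:
  fixes P :: "'a :: field mat"
  assumes "permutation_mat n P"
  shows "transpose_mat P * P = 1\<^sub>m n" "P * transpose_mat P = 1\<^sub>m n"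
proof -
  obtain p where p: "p permutes {..<n}" and P: "P = mat n n (\<lambda>(i, j). if i = p j then 1 else 0)"
    using assms unfolding permutation_mat_def by auto
  have car: "P \<in> carrier_mat n n" by (simp add: P)
  show *: "transpose_mat P * P = 1\<^sub>m n"
  proof (rule eq_matI)
    fix i j assume "i < dim_row (1\<^sub>m n :: 'a mat)" "j < dim_col (1\<^sub>m n :: 'a mat)"
    then have ij: "i < n" "j < n" by auto
    then have "p i < n" "p j < n" using permutes_in_image[OF p] by auto
    moreover have "p i = p j \<longleftrightarrow> i = j"
      using permutes_inj[OF p] by (auto dest: injD)
    moreover have "transpose_mat P * 1\<^sub>m n = transpose_mat P"
      using car by simp
    ultimately show "(transpose_mat P * P) $$ (i, j) = 1\<^sub>m n $$ (i, j)"
      using index_permutation_conj[OF p _ ij P, of "1\<^sub>m n"] ij by simp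
  qed (use car in auto)
  show "P * transpose_mat P = 1\<^sub>m n"
    using mat_mult_left_right_inverse[OF _ _ *] car by auto
qed

lemma block_triangular_mat_iff:
  assumes "B \<in> carrier_mat n n"
  shows "block_triangular_mat B \<longleftrightarrow>
    (\<exists>k. 0 < k \<and> k < n \<and> (\<forall>i j. k \<le> i \<and> i < n \<and> j < k \<longrightarrow> B $$ (i, j) = 0))"
    (is "_ \<longleftrightarrow> ?R")
proof
  assume "block_triangular_mat B"
  then obtain k m A11 A12 A22 where km: "0 < k" "0 < m"
    and car: "A11 \<in> carrier_mat k k" "A12 \<in> carrier_mat k m" "A22 \<in> carrier_mat m m"
    and B: "B = four_block_mat A11 A12 (0\<^sub>m m k) A22"
    unfolding block_triangular_mat_def by auto
  have "n = k + m" using assms car unfolding B by auto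
  then show ?R
    using km car by (intro exI[of _ k]) (auto simp: B)
next
  assume ?R
  then obtain k where k: "0 < k" "k < n"
    and zero: "\<And>i j. k \<le> i \<Longrightarrow> i < n \<Longrightarrow> j < k \<Longrightarrow> B $$ (i, j) = 0"
    by auto
  have "B = four_block_mat (mat k k (\<lambda>(i, j). B $$ (i, j))) (mat k (n - k) (\<lambda>(i, j). B $$ (i, j + k)))
      (0\<^sub>m (n - k) k) (mat (n - k) (n - k) (\<lambda>(i, j). B $$ (i + k, j + k)))"
    using assms k zero by (intro eq_matI) auto
  then show "block_triangular_mat B"
    unfolding block_triangular_mat_def using k
    by (intro exI[of _ k] exI[of _ "n - k"] exI conjI) auto
qed

text \<open>Relabels an arbitrary index set as an initial segment, which turns a zero pattern
  indexed by \<open>S\<close> into a corner block.\<close>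

lemma ex_permutes_image_lessThan:
  fixes S :: "nat set"
  assumes "S \<subseteq> {..<n}"
  shows "\<exists>p. p permutes {..<n} \<and> p ` {..<card S} = S"
proof -
  have fin: "finite S" using assms finite_subset by blast
  have le: "card S \<le> n" using card_mono[OF _ assms] by simp
  obtain f where f: "bij_betw f {..<card S} S"
    using fin by (metis card_lessThan finite_lessThan finite_same_card_bij)
  \<comment> \<open>The complements have equal size too, so a bijection onto \<open>S\<close>
    extends to a permutation.\<close>
  have "card ({..<n} - {..<card S}) = card ({..<n} - S)"
    using le assms fin by (simp add: card_Diff_subset)
  then obtain g where g: "bij_betw g ({..<n} - {..<card S}) ({..<n} - S)"
    by (metis finite_Diff finite_lessThan finite_same_card_bij)
  define p where "p x = (if x < card S then f x else if x < n then g x else x)" for x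
  have pf: "bij_betw p {..<card S} S"
    using f by (rule bij_betw_cong[THEN iffD1, rotated]) (simp add: p_def)
  have pg: "bij_betw p ({..<n} - {..<card S}) ({..<n} - S)"
    using g by (rule bij_betw_cong[THEN iffD1, rotated]) (simp add: p_def)
  have "bij_betw p ({..<card S} \<union> ({..<n} - {..<card S})) (S \<union> ({..<n} - S))"
    by (rule bij_betw_combine[OF pf pg]) auto
  moreover have "{..<card S} \<union> ({..<n} - {..<card S}) = {..<n}" "S \<union> ({..<n} - S) = {..<n}"
    using le assms by auto
  ultimately have "p permutes {..<n}"
    using le by (intro bij_imp_permutes) (auto simp: p_def)
  then show ?thesis using bij_betw_imp_surj_on[OF pf] by blast
qed

text \<open>This is strong connectivity of the digraph, phrased by cuts. A set \<open>S\<close>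
  without a nonzero entry in rows outside \<open>S\<close> and columns in \<open>S\<close> is
  exactly what becomes a zero lower left block once the indices in \<open>S\<close> are listed
  first.\<close>

lemma irreducible_mat_iff:
  fixes A :: "'a :: field mat"
  assumes A: "A \<in> carrier_mat n n"
  shows "irreducible_mat A \<longleftrightarrow>
    (\<forall>S. S \<noteq> {} \<and> S \<subset> {..<n} \<longrightarrow> (\<exists>i \<in> {..<n} - S. \<exists>j \<in> S. A $$ (i, j) \<noteq> 0))"
    (is "_ \<longleftrightarrow> ?R")
proof
  assume irr: "irreducible_mat A"
  show ?R
  proof (intro allI impI, rule ccontr)
    fix S assume S: "S \<noteq> {} \<and> S \<subset> {..<n}"
      and "\<not> (\<exists>i \<in> {..<n} - S. \<exists>j \<in> S. A $$ (i, j) \<noteq> 0)"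
    then have zero: "A $$ (i, j) = 0" if "i < n" "i \<notin> S" "j \<in> S" for i j
      using that by auto
    obtain p where p: "p permutes {..<n}" and im: "p ` {..<card S} = S"
      using ex_permutes_image_lessThan[of S n] S by auto
    have kpos: "0 < card S" "card S < n"
      using S psubset_card_mono[of "{..<n}" S] finite_subset[of S "{..<n}"]
      by (auto simp: card_gt_0_iff)
    define P :: "'a mat" where "P = mat n n (\<lambda>(i, j). if i = p j then 1 else 0)"
    have car: "P \<in> carrier_mat n n" by (simp add: P_def)
    have perm: "permutation_mat n P" unfolding permutation_mat_def P_def using p by blast
    note orth = permutation_mat_orthogonal[OF perm]
    define B where "B = transpose_mat P * A * P"
    have carB: "B \<in> carrier_mat n n" using car A by (simp add: B_def)
    have "similar_mat_wit B A (transpose_mat P) P"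
      by (rule similar_mat_witI[OF orth B_def carB A]) (use car in auto)
    then have sim: "similar_mat_wit A B P (transpose_mat P)"
      by (rule similar_mat_wit_sym)
    have "B $$ (i, j) = 0" if "card S \<le> i" "i < n" "j < card S" for i j
    proof -
      have "p i \<notin> S"
      proof
        assume "p i \<in> S"
        then obtain x where "x < card S" "p x = p i" using im by (metis imageE lessThan_iff)
        then show False using permutes_inj[OF p] that by (metis injD leD)
      qed
      moreover have "p i < n" using permutes_in_image[OF p] that by auto
      moreover have "p j \<in> S" using im that by auto
      ultimately show ?thesis
        unfolding B_def using index_permutation_conj[OF p A _ _ P_def, of i j] zero that kpos
        by auto
    qed
    then have "block_triangular_mat B"
      unfolding block_triangular_mat_iff[OF carB] using kpos by blast
    then show False
      using irr perm sim A unfolding irreducible_mat_def by auto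
  qed
next
  assume R: ?R
  show "irreducible_mat A"
    unfolding irreducible_mat_def
  proof (intro conjI notI)
    show "square_mat A" using A by auto
    assume "\<exists>P B. permutation_mat (dim_row A) P \<and>
              similar_mat_wit A B P (transpose_mat P) \<and> block_triangular_mat B"
    then obtain P B where perm: "permutation_mat n P" 
      and sim: "similar_mat_wit A B P (transpose_mat P)" and B: "block_triangular_mat B"
      using A by auto
    obtain p where p: "p permutes {..<n}" and P: "P = mat n n (\<lambda>(i, j). if i = p j then 1 else 0)"
      using perm unfolding permutation_mat_def by auto
    have carB: "B \<in> carrier_mat n n" using similar_mat_witD2[OF A sim] by auto
    have Beq: "B = transpose_mat P * A * P"
      using similar_mat_witD2(3)[OF carB similar_mat_wit_sym[OF sim]] by simp
    obtain k where k: "0 < k" "k < n"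
      and zero: "\<And>i j. k \<le> i \<Longrightarrow> i < n \<Longrightarrow> j < k \<Longrightarrow> B $$ (i, j) = 0"
      using B unfolding block_triangular_mat_iff[OF carB] by auto
    have pim: "p ` {..<n} = {..<n}" by (rule permutes_image[OF p])
    \<comment> \<open>The cut is taken at the image of the first \<open>k\<close> indices: the
      nonzero entry of \<open>A\<close> that it provides lies in the zero block of
      \<open>B\<close>.\<close>
    have "p ` {..<k} \<subseteq> {..<n}" using pim k by auto
    moreover have "card (p ` {..<k}) = k"
      using card_image[OF inj_on_subset[OF permutes_inj[OF p]]] by auto
    ultimately have "p ` {..<k} \<subset> {..<n}" using k by auto
    moreover have "p ` {..<k} \<noteq> {}" using k by auto
    ultimately obtain i y where "i \<in> {..<n} - p ` {..<k}" "y \<in> p ` {..<k}" "A $$ (i, y) \<noteq> 0"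
      using R by meson
    then obtain j where ij: "i < n" "i \<notin> p ` {..<k}" "j < k" "A $$ (i, p j) \<noteq> 0"
      by auto
    then obtain i' where i': "i' < n" "i = p i'" using pim by (metis imageE lessThan_iff)
    with ij have "k \<le> i'" by force
    then have "B $$ (i', j) = 0" using zero i' ij by simp
    then show False
      using index_permutation_conj[OF p A _ _ P, of i' j] i' ij k unfolding Beq by simp
  qed
qed

section \<open>Characteristic polynomial and spectrum of a 3-by-3 matrix\<close>

lemma det_3:
  fixes A :: "'a :: comm_ring_1 mat"
  assumes A: "A \<in> carrier_mat 3 3"
  shows "det A =
    A $$ (0,0) * A $$ (1,1) * A $$ (2,2)
    - A $$ (0,0) * (A $$ (1,2) * A $$ (2,1)) - A $$ (1,1) * (A $$ (0,2) * A $$ (2,0))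
    - A $$ (2,2) * (A $$ (0,1) * A $$ (1,0))
    + A $$ (0,1) * A $$ (1,2) * A $$ (2,0) + A $$ (0,2) * A $$ (2,1) * A $$ (1,0)"
proof -
  have det_2: "det B = B $$ (0,0) * B $$ (1,1) - B $$ (1,0) * B $$ (0,1)"
    if B: "B \<in> carrier_mat 2 2" for B :: "'a mat"
  proof -
    have "det B = (\<Sum>i<2. B $$ (i,0) * cofactor B i 0)"
      by (rule laplace_expansion_column[OF B]) simp
    moreover have "cofactor B 0 0 = B $$ (1,1)" "cofactor B 1 0 = - B $$ (0,1)"
      using B by (simp_all add: cofactor_def det_single mat_delete_def)
    ultimately show ?thesis
      by (simp add: numeral_2_eq_2 lessThan_Suc)
  qed
  have "det A = (\<Sum>i<3. A $$ (i,0) * cofactor A i 0)"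
    by (rule laplace_expansion_column[OF A]) simp
  also have "\<dots> = A $$ (0,0) * cofactor A 0 0 + A $$ (1,0) * cofactor A 1 0 + A $$ (2,0) * cofactor A 2 0"
    by (simp add: eval_nat_numeral lessThan_Suc)
  finally have "det A = A $$ (0,0) * cofactor A 0 0 + A $$ (1,0) * cofactor A 1 0 + A $$ (2,0) * cofactor A 2 0" .
  moreover have cof: "cofactor A 0 0 = A $$ (1,1) * A $$ (2,2) - A $$ (1,2) * A $$ (2,1)"
    "cofactor A 1 0 = - (A $$ (0,1) * A $$ (2,2) - A $$ (0,2) * A $$ (2,1))"
    "cofactor A 2 0 = A $$ (0,1) * A $$ (1,2) - A $$ (0,2) * A $$ (1,1)"
    using A by (simp_all add: cofactor_def det_2 mat_delete_def algebra_simps flip: numeral_2_eq_2)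
  ultimately show ?thesis
    unfolding cof by (simp add: algebra_simps)
qed

definition trace3 :: "'a :: comm_ring_1 mat \<Rightarrow> 'a" where
  "trace3 A = A $$ (0,0) + A $$ (1,1) + A $$ (2,2)"

text \<open>The sum of the principal 2-by-2 minors, that is, the second elementary symmetric
  function of the eigenvalues.\<close>

definition minors3 :: "'a :: comm_ring_1 mat \<Rightarrow> 'a" where
  "minors3 A = A $$ (0,0) * A $$ (1,1) + A $$ (0,0) * A $$ (2,2) + A $$ (1,1) * A $$ (2,2)
    - A $$ (0,1) * A $$ (1,0) - A $$ (1,2) * A $$ (2,1) - A $$ (0,2) * A $$ (2,0)"

lemma char_poly_3:
  fixes A :: "'a :: comm_ring_1 mat"
  assumes A: "A \<in> carrier_mat 3 3"
  shows "char_poly A = [:- det A, minors3 A, - trace3 A, 1:]"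
proof -
  have "char_poly_matrix A \<in> carrier_mat 3 3" using A by simp
  moreover have "char_poly_matrix A $$ (i, j) = (if i = j then [:- A $$ (i,j), 1:] else [:- A $$ (i,j):])"
    if "i < 3" "j < 3" for i j
    using that A by (simp add: char_poly_matrix_def)
  ultimately show ?thesis
    using A unfolding char_poly_def
    by (simp add: det_3 trace3_def minors3_def algebra_simps)
qed

lemma proots_eq_iff_linear_factors:
  fixes p :: "complex poly"
  assumes "monic p"
  shows "proots p = \<sigma> \<longleftrightarrow> p = (\<Prod>x\<in>#\<sigma>. [:-x, 1:])"
proof
  assume "proots p = \<sigma>"
  then show "p = (\<Prod>x\<in>#\<sigma>. [:-x, 1:])"
    using complex_poly_decompose_multiset[of p] assms by simp
next
  assume "p = (\<Prod>x\<in>#\<sigma>. [:-x, 1:])"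
  moreover have "proots (\<Prod>x\<in>#\<sigma>. [:-x, 1:]) = \<sigma>"
  proof (induction \<sigma>)
    case (add x \<sigma>)
    have "(\<Prod>x\<in>#\<sigma>. [:-x, 1:]) \<noteq> (0 :: complex poly)" by (auto simp: prod_mset_zero_iff)
    then show ?case
      using add by (simp add: proots_mult del: mult_pCons_left)
  qed simp
  ultimately show "proots p = \<sigma>" by simp
qed

lemma char_poly_3_of_real:
  assumes A: "A \<in> carrier_mat 3 3"
  shows "char_poly (map_mat complex_of_real A) =
    [:- of_real (det A), of_real (minors3 A), - of_real (trace3 A), 1:]"
proof -
  let ?C = "map_mat complex_of_real A"
  have C: "?C \<in> carrier_mat 3 3" using A by simp
  have "trace3 ?C = of_real (trace3 A)" "minors3 ?C = of_real (minors3 A)" "det ?C = of_real (det A)"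
    using A by (simp_all add: trace3_def minors3_def)
  then show ?thesis using char_poly_3[OF C] by simp
qed

text \<open>Vieta: over the complex numbers a monic polynomial and its multiset of roots determine
  each other, so comparing coefficients suffices.\<close>

lemma eigenvalue_mset_3_iff:
  assumes A: "A \<in> carrier_mat 3 3"
  shows "eigenvalue_mset A = {#x, y, z#} \<longleftrightarrow>
    complex_of_real (trace3 A) = x + y + z \<and> complex_of_real (minors3 A) = x * y + x * z + y * z \<and>
    complex_of_real (det A) = x * y * z"
  unfolding eigenvalue_mset_def char_poly_3_of_real[OF A]
  by (subst proots_eq_iff_linear_factors) (auto simp: algebra_simps)

lemma eigenvalue_mset_root:
  assumes A: "A \<in> carrier_mat 3 3" and w: "w \<in># eigenvalue_mset A"
  shows "w ^ 3 - of_real (trace3 A) * w\<^sup>2 + of_real (minors3 A) * w - of_real (det A) = 0"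
proof -
  have "poly [:- of_real (det A), of_real (minors3 A), - of_real (trace3 A), 1:] w = 0"
    using w unfolding eigenvalue_mset_def char_poly_3_of_real[OF A] by simp
  then have "- of_real (det A) + w * (of_real (minors3 A) + w * (- of_real (trace3 A) + w)) = 0"
    by simp
  moreover have "w ^ 3 - of_real (trace3 A) * w\<^sup>2 + of_real (minors3 A) * w - of_real (det A)
      = - of_real (det A) + w * (of_real (minors3 A) + w * (- of_real (trace3 A) + w))"
    by (simp add: power3_eq_cube power2_eq_square algebra_simps)
  ultimately show ?thesis by (simp only:)
qed

section \<open>Reducible nonnegative 3-by-3 matrices\<close>

lemma real_of_shifted_product_nonneg:
  assumes eq: "(w - complex_of_real d) * (w - complex_of_real e) = of_real u" and u: "0 \<le> u"
  shows "Im w = 0"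
proof (rule ccontr)
  assume nz: "Im w \<noteq> 0"
  have im: "Im w * (2 * Re w - d - e) = 0"
    using arg_cong[OF eq, of Im] by (simp add: algebra_simps)
  have re: "(Re w - d) * (Re w - e) - (Im w)\<^sup>2 = u"
    using arg_cong[OF eq, of Re] by (simp add: power2_eq_square)
  \<comment> \<open>The real part of a nonreal root would be the midpoint of \<open>d\<close> and
    \<open>e\<close>, and there the product is negative.\<close>
  have d: "d = 2 * Re w - e" using im nz by simp
  have "u = - (Re w - e)\<^sup>2 - (Im w)\<^sup>2"
    unfolding re[symmetric] d by (simp add: power2_eq_square algebra_simps)
  moreover have "(Im w)\<^sup>2 > 0" "(Re w - e)\<^sup>2 \<ge> 0" using nz by simp_all
  ultimately show False using u by linarith
qed

text \<open>The proper nonempty subsets of three indices are singletons and pairs: each singleton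
  cut gives a column condition, each pair cut a row condition.\<close>

lemma irreducible_mat_3_iff:
  fixes A :: "'a :: field mat"
  assumes A: "A \<in> carrier_mat 3 3"
  shows "irreducible_mat A \<longleftrightarrow>
    (A $$ (1,0) \<noteq> 0 \<or> A $$ (2,0) \<noteq> 0) \<and> (A $$ (0,1) \<noteq> 0 \<or> A $$ (2,1) \<noteq> 0) \<and>
    (A $$ (0,2) \<noteq> 0 \<or> A $$ (1,2) \<noteq> 0) \<and> (A $$ (0,1) \<noteq> 0 \<or> A $$ (0,2) \<noteq> 0) \<and>
    (A $$ (1,0) \<noteq> 0 \<or> A $$ (1,2) \<noteq> 0) \<and> (A $$ (2,0) \<noteq> 0 \<or> A $$ (2,1) \<noteq> 0)"
proof -
  note iff = irreducible_mat_iff[OF A]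
  show ?thesis (is "_ \<longleftrightarrow> ?R")
  proof
    assume "irreducible_mat A"
    then have R: "\<exists>i \<in> {..<3} - S. \<exists>j \<in> S. A $$ (i, j) \<noteq> 0"
      if "S \<noteq> {}" "S \<subseteq> {..<3}" "k < 3" "k \<notin> S" for S k
      using that unfolding iff by (metis lessThan_iff psubsetI)
    have diff: "{..<3} - {0} = {1, 2 :: nat}" "{..<3} - {1} = {0, 2 :: nat}"
      "{..<3} - {2} = {0, 1 :: nat}" "{..<3} - {1, 2} = {0 :: nat}"
      "{..<3} - {0, 2} = {1 :: nat}" "{..<3} - {0, 1} = {2 :: nat}"
      by auto
    have "A $$ (1,0) \<noteq> 0 \<or> A $$ (2,0) \<noteq> 0"
      using R[of "{0}" 1] unfolding diff by simp
    moreover have "A $$ (0,1) \<noteq> 0 \<or> A $$ (2,1) \<noteq> 0"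
      using R[of "{1}" 0] unfolding diff by simp
    moreover have "A $$ (0,2) \<noteq> 0 \<or> A $$ (1,2) \<noteq> 0"
      using R[of "{2}" 0] unfolding diff by simp
    moreover have "A $$ (0,1) \<noteq> 0 \<or> A $$ (0,2) \<noteq> 0"
      using R[of "{1, 2}" 0] unfolding diff by simp
    moreover have "A $$ (1,0) \<noteq> 0 \<or> A $$ (1,2) \<noteq> 0"
      using R[of "{0, 2}" 1] unfolding diff by simp
    moreover have "A $$ (2,0) \<noteq> 0 \<or> A $$ (2,1) \<noteq> 0"
      using R[of "{0, 1}" 2] unfolding diff by simp
    ultimately show ?R by blast
  next
    assume R: ?R
    show "irreducible_mat A"
      unfolding iff
    proof (intro allI impI, rule ccontr)
      fix S assume S: "S \<noteq> {} \<and> S \<subset> {..<3 :: nat}"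
        and "\<not> (\<exists>i \<in> {..<3} - S. \<exists>j \<in> S. A $$ (i, j) \<noteq> 0)"
      then have zero: "A $$ (i, j) = 0" if "i < 3" "i \<notin> S" "j \<in> S" for i j
        using that by auto
      have three: "i < 3 \<longleftrightarrow> i = 0 \<or> i = 1 \<or> i = 2" for i :: nat by auto
      obtain j k where "j \<in> S" "j < 3" "k < 3" "k \<notin> S"
        using S by (metis all_not_in_conv lessThan_iff psubset_imp_ex_mem subsetD psubset_imp_subset DiffE)
      then have "0 \<in> S \<or> 1 \<in> S \<or> 2 \<in> S" "\<not> (0 \<in> S \<and> 1 \<in> S \<and> 2 \<in> S)"
        using three by metis+
      moreover have "0 < (3::nat)" "1 < (3::nat)" "2 < (3::nat)" by simp_all
      ultimately show False
        using R zero[of 0 1] zero[of 0 2] zero[of 1 0] zero[of 1 2] zero[of 2 0] zero[of 2 1]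
        by argo
    qed
  qed
qed

text \<open>The characteristic polynomial splits off a linear factor belonging to one diagonal
  entry; the remaining quadratic is that of a nonnegative 2-by-2 block, whose discriminant is
  nonnegative.\<close>

lemma reducible_nonneg_3_real_eigenvalues:
  assumes A: "A \<in> carrier_mat 3 3" and nonneg: "nonneg_mat A" and red: "\<not> irreducible_mat A"
    and w: "w \<in># eigenvalue_mset A"
  shows "Im w = 0"
proof -
  define p q r u v m s t where
    "p = A $$ (0,0)" and "q = A $$ (1,1)" and "r = A $$ (2,2)" and
    "u = A $$ (0,1) * A $$ (1,0)" and "v = A $$ (1,2) * A $$ (2,1)" and
    "m = A $$ (0,2) * A $$ (2,0)" and
    "s = A $$ (0,1) * A $$ (1,2) * A $$ (2,0)" and "t = A $$ (0,2) * A $$ (2,1) * A $$ (1,0)"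
  note defs = this
  have "0 \<le> A $$ (i, j)" if "i < 3" "j < 3" for i j
    using nonneg A that by (auto simp: nonneg_mat_def)
  then have ge: "0 \<le> u" "0 \<le> v" "0 \<le> m"
    unfolding defs by simp_all
  have mi: "minors3 A = p * q + p * r + q * r - u - v - m"
    unfolding minors3_def defs ..
  have de: "det A = p * q * r - p * v - q * m - r * u + s + t"
    unfolding det_3[OF A] defs ..
  have root: "w ^ 3 - of_real (p + q + r) * w\<^sup>2 + of_real (minors3 A) * w - of_real (det A) = 0"
    using eigenvalue_mset_root[OF A w] unfolding trace3_def defs .
  let ?d = "\<lambda>x. w - complex_of_real x"
  \<comment> \<open>The characteristic polynomial at \<open>w\<close>, sorted by cycles instead of
    powers of \<open>w\<close>.\<close>
  have "?d p * ?d q * ?d r - of_real u * ?d r - of_real v * ?d p - of_real m * ?d q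
      - of_real s - of_real t
    = w ^ 3 - of_real (p + q + r) * w\<^sup>2 + of_real (minors3 A) * w - of_real (det A)"
    unfolding mi de by (simp add: power2_eq_square power3_eq_cube algebra_simps)
  then have root': "?d p * ?d q * ?d r - of_real u * ?d r - of_real v * ?d p - of_real m * ?d q
      - of_real s - of_real t = 0"
    unfolding root .
  have factor: "Im w = 0" if "?d x * (?d y * ?d z - of_real k) = 0" "0 \<le> k" for x y z k
    using real_of_shifted_product_nonneg[of w y z k] that by auto
  \<comment> \<open>If the row or column of index 0, 1 or 2 vanishes off the diagonal, every cycle
    of length at least 2 through that index has product zero; this includes both 3-cycles.\<close>
  consider "u = 0" "m = 0" "s = 0" "t = 0" | "u = 0" "v = 0" "s = 0" "t = 0"
    | "v = 0" "m = 0" "s = 0" "t = 0"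
    using red unfolding irreducible_mat_3_iff[OF A] defs by auto
  then show ?thesis
  proof cases
    case 1
    then have "?d p * (?d q * ?d r - of_real v) = 0"
      using root' by (simp add: algebra_simps)
    then show ?thesis using factor ge by blast
  next
    case 2
    then have "?d q * (?d p * ?d r - of_real m) = 0"
      using root' by (simp add: algebra_simps)
    then show ?thesis using factor ge by blast
  next
    case 3
    then have "?d r * (?d p * ?d q - of_real u) = 0"
      using root' by (simp add: algebra_simps)
    then show ?thesis using factor ge by blast
  qed
qed

section \<open>The exceptional lists \<open>{a, b, -a}\<close>\<close>

lemma not_irreducibly_realizable_imprimitive:
  fixes a b :: real
  assumes "b < a" "0 < b"
  shows "\<not> irreducibly_realizable {#complex_of_real a, complex_of_real b, - complex_of_real a#}"
proof
  assume "irreducibly_realizable {#complex_of_real a, complex_of_real b, - complex_of_real a#}"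
  then obtain A where A: "A \<in> carrier_mat 3 3" and nonneg: "nonneg_mat A"
    and irr: "irreducible_mat A"
    and ev: "eigenvalue_mset A = {#complex_of_real a, complex_of_real b, - complex_of_real a#}"
    unfolding irreducibly_realizable_def by (auto simp: numeral_3_eq_3)
  define p q r u v w s t where
    "p = A $$ (0,0)" and "q = A $$ (1,1)" and "r = A $$ (2,2)" and
    "u = A $$ (0,1) * A $$ (1,0)" and "v = A $$ (1,2) * A $$ (2,1)" and
    "w = A $$ (0,2) * A $$ (2,0)" and
    "s = A $$ (0,1) * A $$ (1,2) * A $$ (2,0)" and "t = A $$ (0,2) * A $$ (2,1) * A $$ (1,0)"
  note defs = this
  have entries: "0 \<le> A $$ (i, j)" if "i < 3" "j < 3" for i j
    using nonneg A that by (auto simp: nonneg_mat_def)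
  have ge: "0 \<le> p" "0 \<le> q" "0 \<le> r" "0 \<le> u" "0 \<le> v" "0 \<le> w" "0 \<le> s" "0 \<le> t"
    unfolding defs by (simp_all add: entries)
  have "complex_of_real (trace3 A) = of_real b" "complex_of_real (minors3 A) = of_real (- a\<^sup>2)"
    "complex_of_real (det A) = of_real (- a\<^sup>2 * b)"
    using ev unfolding eigenvalue_mset_3_iff[OF A] by (simp_all add: power2_eq_square algebra_simps)
  then have tr: "trace3 A = b" and mi: "minors3 A = - a\<^sup>2" and de: "det A = - a\<^sup>2 * b"
    by (simp_all only: of_real_eq_iff)
  have b: "p + q + r = b" using tr unfolding trace3_def defs .
  have mi': "minors3 A = p * q + p * r + q * r - u - v - w"
    unfolding minors3_def defs ..
  have de': "det A = p * q * r - p * v - q * w - r * u + s + t"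
    unfolding det_3[OF A] defs ..
  have m: "u + v + w = p * q + p * r + q * r + a\<^sup>2"
    using mi mi' by linarith
  \<comment> \<open>This relation expresses that the characteristic polynomial is
    \<open>(X - b) * (X^2 - a^2)\<close>, whose quadratic factor has no linear term.\<close>
  have "det A = minors3 A * (p + q + r)" unfolding de mi b ..
  then have key: "(p + q) * (q + r) * (p + r) = u * (p + q) + v * (q + r) + w * (p + r) + s + t"
    unfolding de' mi' by (simp add: algebra_simps)
  have "b\<^sup>2 < a\<^sup>2" using assms by (simp add: power_strict_mono)
  then have big: "(p + q + r)\<^sup>2 < u + v + w"
    using m ge b by (smt (verit) mult_nonneg_nonneg)
  \<comment> \<open>A positive lower bound \<open>x\<close> of the pairwise sums makes the right
    side of \<open>key\<close> at least \<open>x * (u + v + w)\<close>, which by \<open>big\<close>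
    exceeds the bound assumed for the left side.\<close>
  have no_positive_min: False
    if "0 < x" "x \<le> p + q" "x \<le> q + r" "x \<le> p + r" "(p + q) * (q + r) * (p + r) \<le> x * (p + q + r)\<^sup>2" for x
  proof -
    have "x * (p + q + r)\<^sup>2 < x * (u + v + w)" using big that by simp
    also have "\<dots> \<le> u * (p + q) + v * (q + r) + w * (p + r)"
      using that ge mult_left_mono[of x "p + q" u] mult_left_mono[of x "q + r" v]
        mult_left_mono[of x "p + r" w] by (simp add: algebra_simps)
    finally show False using key ge that by linarith
  qed
  have pq: "(q + r) * (p + r) \<le> (p + q + r)\<^sup>2" "(p + q) * (p + r) \<le> (p + q + r)\<^sup>2"
    "(p + q) * (q + r) \<le> (p + q + r)\<^sup>2"
    unfolding power2_eq_square using ge by (auto intro!: mult_mono)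
  \<comment> \<open>If a pairwise sum vanishes, the left side of \<open>key\<close> is zero, so all
    its nonnegative summands on the right vanish and only one 2-cycle can survive. The index off
    that 2-cycle then has a zero row or column off the diagonal.\<close>
  have pos: "0 < p + q \<and> 0 < q + r \<and> 0 < p + r"
  proof (rule ccontr)
    assume "\<not> (0 < p + q \<and> 0 < q + r \<and> 0 < p + r)"
    then consider "p = 0" "q = 0" "r = b" | "q = 0" "r = 0" "p = b" | "p = 0" "r = 0" "q = b"
      using ge b by linarith
    then show False
    proof cases
      case 1
      then have "v * b + w * b + s + t = 0" using key by simp
      then have "v * b = 0" "w * b = 0" "s = 0" "t = 0"
        using ge assms by (smt (verit) mult_nonneg_nonneg)+
      then have z: "v = 0" "w = 0" "s = 0" "t = 0" using assms by auto
      have "0 \<le> (p + q + r)\<^sup>2" by simp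
      then have "u \<noteq> 0" using big z by linarith
      then show False
        using z irr unfolding irreducible_mat_3_iff[OF A] defs by auto
    next
      case 2
      then have "u * b + w * b + s + t = 0" using key by simp
      then have "u * b = 0" "w * b = 0" "s = 0" "t = 0"
        using ge assms by (smt (verit) mult_nonneg_nonneg)+
      then have z: "u = 0" "w = 0" "s = 0" "t = 0" using assms by auto
      have "0 \<le> (p + q + r)\<^sup>2" by simp
      then have "v \<noteq> 0" using big z by linarith
      then show False
        using z irr unfolding irreducible_mat_3_iff[OF A] defs by auto
    next
      case 3
      then have "u * b + v * b + s + t = 0" using key by simp
      then have "u * b = 0" "v * b = 0" "s = 0" "t = 0"
        using ge assms by (smt (verit) mult_nonneg_nonneg)+
      then have z: "u = 0" "v = 0" "s = 0" "t = 0" using assms by auto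
      have "0 \<le> (p + q + r)\<^sup>2" by simp
      then have "w \<noteq> 0" using big z by linarith
      then show False
        using z irr unfolding irreducible_mat_3_iff[OF A] defs by auto
    qed
  qed
  \<comment> \<open>The bound \<open>x\<close> is taken to be the least pairwise sum; by
    \<open>pq\<close> the product of the other two is at most the squared trace.\<close>
  consider "p + q \<le> q + r" "p + q \<le> p + r" | "q + r \<le> p + q" "q + r \<le> p + r"
    | "p + r \<le> p + q" "p + r \<le> q + r"
    by linarith
  then show False
  proof cases
    case 1
    then show False
      using no_positive_min[of "p + q"] pos mult_left_mono[OF pq(1), of "p + q"]
      by (simp add: mult.assoc)
  next
    case 2
    then show False
      using no_positive_min[of "q + r"] pos mult_left_mono[OF pq(2), of "q + r"]
      by (simp add: mult.assoc mult.left_commute)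
  next
    case 3
    then show False
      using no_positive_min[of "p + r"] pos mult_left_mono[OF pq(3), of "p + r"]
      by (simp add: mult.commute mult.left_commute)
  qed
qed

section \<open>Explicit irreducible realizations of real lists\<close>

lemma irreducibly_realizable_3I:
  fixes x y z :: real
  assumes nonneg: "0 \<le> a" "0 \<le> b" "0 \<le> c" "0 \<le> d" "0 \<le> e" "0 \<le> f" "0 \<le> g" "0 \<le> h" "0 \<le> k"
    and irr: "d \<noteq> 0 \<or> g \<noteq> 0" "b \<noteq> 0 \<or> h \<noteq> 0" "c \<noteq> 0 \<or> f \<noteq> 0"
      "b \<noteq> 0 \<or> c \<noteq> 0" "d \<noteq> 0 \<or> f \<noteq> 0" "g \<noteq> 0 \<or> h \<noteq> 0"
    and coeffs: "a + e + k = x + y + z"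
      "a * e + a * k + e * k - b * d - f * h - c * g = x * y + x * z + y * z"
      "a * e * k - a * (f * h) - e * (c * g) - k * (b * d) + b * f * g + c * h * d = x * y * z"
  shows "irreducibly_realizable {#complex_of_real x, complex_of_real y, complex_of_real z#}"
proof -
  define A where "A = mat_of_rows_list 3 [[a, b, c], [d, e, f], [g, h, k]]"
  have A: "A \<in> carrier_mat 3 3"
    by (intro carrier_matI) (simp_all add: A_def mat_of_rows_list_def)
  have entry: "A $$ (0,0) = a" "A $$ (0,1) = b" "A $$ (0,2) = c" "A $$ (1,0) = d" "A $$ (1,1) = e"
    "A $$ (1,2) = f" "A $$ (2,0) = g" "A $$ (2,1) = h" "A $$ (2,2) = k"
    by (simp_all add: A_def mat_of_rows_list_def)
  have "\<forall>i \<in> {0, 1, 2}. \<forall>j \<in> {0, 1, 2}. 0 \<le> A $$ (i, j)"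
    using nonneg by (simp only: ball_simps entry simp_thms)
  moreover have "i < 3 \<longleftrightarrow> i \<in> {0, 1, 2}" for i :: nat by auto
  ultimately have "nonneg_mat A"
    using A unfolding nonneg_mat_def by auto
  moreover have "irreducible_mat A"
    unfolding irreducible_mat_3_iff[OF A] entry using irr by simp
  moreover have "trace3 A = x + y + z" "minors3 A = x * y + x * z + y * z" "det A = x * y * z"
    unfolding trace3_def minors3_def det_3[OF A] entry using coeffs by simp_all
  then have "eigenvalue_mset A = {#complex_of_real x, complex_of_real y, complex_of_real z#}"
    unfolding eigenvalue_mset_3_iff[OF A] by simp
  ultimately show ?thesis
    using A unfolding irreducibly_realizable_def by (auto simp: numeral_3_eq_3)
qed

text \<open>The diagonal entries \<open>c < a\<close> of the tridiagonal matrix with rows \<open>(a, 1, 0)\<close>, \<open>(u, b, 1)\<close>,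
  \<open>(0, v, c)\<close> are the eigenvalues of the submatrix without the middle index. As for Jacobi matrices,
  they strictly interlace the spectrum exactly when \<open>u\<close> and \<open>v\<close>, obtained by evaluating the
  characteristic polynomial at \<open>a\<close> and \<open>c\<close>, are positive.\<close>

lemma irreducibly_realizable_interlacing:
  fixes x y z a c :: real
  assumes "z < c" "c < y" "y < a" "a < x" "0 \<le> c" "a + c \<le> x + y + z"
  shows "irreducibly_realizable {#complex_of_real x, complex_of_real y, complex_of_real z#}"
proof -
  \<comment> \<open>The trace forces \<open>b\<close>, which is nonnegative by the last
    assumption.\<close>
  define b u v where "b = x + y + z - a - c"
    and "u = (x - a) * ((a - y) * (a - z)) / (a - c)"
    and "v = (x - c) * ((y - c) * (c - z)) / (a - c)"
  have pos: "0 < u" "0 < v"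
    unfolding u_def v_def using assms by (intro divide_pos_pos mult_pos_pos; simp)+
  have uv: "(x - a) * ((a - y) * (a - z)) = u * (a - c)" "(x - c) * ((y - c) * (c - z)) = v * (a - c)"
    using assms by (simp_all add: u_def v_def)
  \<comment> \<open>The two remaining coefficients are recovered from the values at \<open>a\<close>
    and \<open>c\<close>, after multiplication by the nonzero \<open>a - c\<close>.\<close>
  have "(u + v) * (a - c) = (x - a) * ((a - y) * (a - z)) + (x - c) * ((y - c) * (c - z))"
    unfolding uv distrib_right ..
  also have "\<dots> = (a * b + a * c + b * c - (x * y + x * z + y * z)) * (a - c)"
    unfolding b_def by (simp add: algebra_simps)
  finally have sum: "u + v = a * b + a * c + b * c - (x * y + x * z + y * z)"
    using assms by simp
  have "(a * b * c - a * v - c * u) * (a - c) = a * b * c * (a - c) - a * (v * (a - c)) - c * (u * (a - c))"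
    by (simp add: algebra_simps)
  also have "\<dots> = x * y * z * (a - c)"
    unfolding uv[symmetric] b_def by (simp add: algebra_simps)
  finally have prod: "a * b * c - a * v - c * u = x * y * z"
    using assms by simp
  show ?thesis
    by (rule irreducibly_realizable_3I[of a 1 0 u b 1 0 v c])
      (use assms pos sum prod in \<open>auto simp: b_def algebra_simps\<close>)
qed

text \<open>Interlacing with a nonnegative \<open>c\<close> strictly between \<open>z\<close> and
  \<open>y\<close> requires \<open>y\<close> positive and different from \<open>z\<close>. The cases
  \<open>y = z\<close>, \<open>y = 0\<close> and \<open>y < 0\<close> therefore get matrices of
  their own.\<close>

lemma irreducibly_realizable_real:
  fixes x y z :: real
  assumes "y < x" "z \<le> y" "- x \<le> z" "0 < x" "0 \<le> x + y + z" and exc: "\<not> (0 < y \<and> z = - x)"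
  shows "irreducibly_realizable {#complex_of_real x, complex_of_real y, complex_of_real z#}"
proof -
  consider "y = z" "0 \<le> y" | "0 \<le> z" "z < y" | "z < 0" "0 < y" | "y = 0" "z < 0" | "y < 0"
    using assms by linarith
  then show ?thesis
  proof cases
    case 1
    \<comment> \<open>Adding the constant matrix with entries \<open>d\<close> to \<open>y\<close>
      times the identity keeps \<open>y\<close> as a double eigenvalue and moves the third to
      \<open>y + 3 * d = x\<close>.\<close>
    define d where "d = (x - y) / 3"
    have "0 < d" "x = y + 3 * d" using assms by (simp_all add: d_def field_simps)
    then show ?thesis
      using 1 by (intro irreducibly_realizable_3I[of "y + d" d d d "y + d" d d d "y + d"])
        (auto simp: algebra_simps)
  next
    case 2
    define m where "m = min (y - z) (x - y) / 2"
    have "0 < m" "2 * m \<le> y - z" "2 * m \<le> x - y"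
      using assms 2 by (auto simp: m_def)
    then show ?thesis
      using assms 2 by (intro irreducibly_realizable_interlacing[of z "z + m" y "y + m" x]) auto
  next
    case 3
    \<comment> \<open>With \<open>c = 0\<close>, a nonnegative middle entry requires
      \<open>m \<le> x + z\<close>. Here \<open>x + z\<close> is positive precisely because the
      exceptional list is excluded.\<close>
    define m where "m = min (x + z) (x - y) / 2"
    have "0 < m" "2 * m \<le> x + z" "2 * m \<le> x - y"
      using assms 3 by (auto simp: m_def)
    then show ?thesis
      using assms 3 by (intro irreducibly_realizable_interlacing[of z 0 y "y + m" x]) auto
  next
    case 4
    \<comment> \<open>Tridiagonal with zero outer diagonal entries: the determinant vanishes, and
      the two equal 2-cycle products must add up to \<open>- x * z\<close>.\<close>
    define u where "u = - x * z / 2"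
    have "0 < u" "x * z = - 2 * u" using assms 4 by (simp_all add: u_def mult_pos_neg)
    then show ?thesis
      using assms 4 by (intro irreducibly_realizable_3I[of 0 1 0 u "x + z" 1 0 u 0]) auto
  next
    case 5
    \<comment> \<open>The companion matrix is nonnegative here: the determinant is positive, and
      \<open>x \<ge> - (y + z) > 0\<close> bounds the second symmetric function by
      \<open>- (y * y + y * z + z * z)\<close>.\<close>
    have det: "0 < x * y * z" using assms 5 by (simp add: mult_pos_neg mult_neg_neg)
    have "x * (y + z) \<le> - (y + z) * (y + z)"
      by (rule mult_right_mono_neg) (use assms 5 in linarith)+
    moreover have "0 \<le> y * z" "0 \<le> y * y" "0 \<le> z * z"
      using assms 5 by (simp_all add: mult_nonpos_nonpos)
    moreover have "x * (y + z) = x * y + x * z" "- (y + z) * (y + z) = - (y * y) - 2 * (y * z) - z * z"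
      by (simp_all add: algebra_simps)
    ultimately have "x * y + x * z + y * z \<le> 0" by linarith
    then show ?thesis
      using assms 5 det
      by (intro irreducibly_realizable_3I[of 0 1 0 0 0 1 "x * y * z" "- (x * y + x * z + y * z)" "x + y + z"])
        auto
  qed
qed

section \<open>From realizable to irreducibly realizable\<close>

lemma irreducibly_realizable_imp_realizable:
  "irreducibly_realizable \<sigma> \<Longrightarrow> realizable \<sigma>"
  unfolding irreducibly_realizable_def realizable_def by blast

text \<open>A reducible realizing matrix still yields useful data: the list is real and its sum, a
  trace, is nonnegative. This is what the explicit constructions need.\<close>

lemma realizable_imp_irreducibly_realizable_3:
  assumes size: "size \<sigma> = 3" and pos: "max_modulus \<sigma> > 0"
    and cnt: "count \<sigma> (complex_of_real (max_modulus \<sigma>)) = 1"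
    and exc: "\<not> (\<exists>a b :: real. a > b \<and> b > 0 \<and>
      \<sigma> = {#complex_of_real a, complex_of_real b, - complex_of_real a#})"
    and real: "realizable \<sigma>"
  shows "irreducibly_realizable \<sigma>"
proof -
  define r where "r = max_modulus \<sigma>"
  obtain A where A: "A \<in> carrier_mat 3 3" and nonneg: "nonneg_mat A" and ev: "eigenvalue_mset A = \<sigma>"
    using real size unfolding realizable_def by auto
  have bound: "cmod w \<le> r" if "w \<in># \<sigma>" for w
    unfolding r_def max_modulus_def using that by (intro Max_ge) auto
  show ?thesis
  proof (cases "irreducible_mat A")
    case True
    then show ?thesis
      using A nonneg ev size unfolding irreducibly_realizable_def by auto
  next
    case False
    have "of_real r \<in># \<sigma>" using cnt by (simp add: r_def count_inI)
    then obtain \<tau> where \<tau>: "\<sigma> = add_mset (of_real r) \<tau>" by (meson multi_member_split)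
    then have "size \<tau> = Suc 1" using size by simp
    then obtain w1 \<tau>' where w1: "\<tau> = add_mset w1 \<tau>'" "size \<tau>' = 1"
      using size_eq_Suc_imp_eq_union[of \<tau> 1] by auto
    then obtain w2 where w: "\<tau> = {#w1, w2#}"
      using size_1_singleton_mset[of \<tau>'] by auto
    have \<sigma>: "\<sigma> = {#of_real r, w1, w2#}" using \<tau> w by simp
    have "Im w1 = 0" "Im w2 = 0"
      using reducible_nonneg_3_real_eigenvalues[OF A nonneg False] by (auto simp: ev \<sigma>)
    then have re: "w1 = of_real (Re w1)" "w2 = of_real (Re w2)"
      by (simp_all add: complex_eq_iff)
    obtain y z :: real where yz: "y \<ge> z" "{#w1, w2#} = {#of_real y, of_real z#}"
    proof (cases "Re w2 \<le> Re w1")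
      case True
      then show ?thesis using that[of "Re w2" "Re w1"] re by simp
    next
      case False
      then show ?thesis using that[of "Re w1" "Re w2"] re add_mset_commute by simp
    qed
    have eq: "\<sigma> = {#complex_of_real r, of_real y, of_real z#}" using \<sigma> yz by simp
    \<comment> \<open>Multiplicity one makes the upper bound \<open>y < r\<close> strict, while
      \<open>z = - r\<close> remains possible.\<close>
    have "complex_of_real r \<notin># {#of_real y, of_real z#}"
      using cnt[folded r_def] unfolding eq by (auto split: if_splits)
    then have "y \<noteq> r" "z \<noteq> r" by auto
    moreover have "\<bar>y\<bar> \<le> r" "\<bar>z\<bar> \<le> r"
      using bound[of "of_real y"] bound[of "of_real z"] by (simp_all add: eq)
    ultimately have order: "y < r" "- r \<le> z" by linarith+
    have "complex_of_real (trace3 A) = of_real (r + y + z)"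
      using ev unfolding eq eigenvalue_mset_3_iff[OF A] by simp
    moreover have "0 \<le> trace3 A"
      using nonneg A by (auto simp: trace3_def nonneg_mat_def)
    ultimately have sum: "0 \<le> r + y + z" by (simp only: of_real_eq_iff)
    have "\<not> (0 < y \<and> z = - r)"
    proof
      assume yz': "0 < y \<and> z = - r"
      then have "\<sigma> = {#complex_of_real r, complex_of_real y, - complex_of_real r#}"
        using eq by simp
      then show False using exc order(1) yz' by blast
    qed
    then show ?thesis
      unfolding eq using irreducibly_realizable_real[OF order(1) yz(1) order(2) _ sum] pos
      by (simp add: r_def)
  qed
qed

theorem mainTheorem2:
  fixes \<sigma> :: "complex multiset"
  assumes "size \<sigma> = 3"
    and "max_modulus \<sigma> > 0"
    and "count \<sigma> (complex_of_real (max_modulus \<sigma>)) = 1"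
  shows
    "(\<not> (\<exists>a b :: real. a > b \<and> b > 0 \<and>
            \<sigma> = {#complex_of_real a, complex_of_real b, - complex_of_real a#})
        \<longrightarrow> (irreducibly_realizable \<sigma> \<longleftrightarrow> realizable \<sigma>)) \<and>
     ((\<exists>a b :: real. a > b \<and> b > 0 \<and>
            \<sigma> = {#complex_of_real a, complex_of_real b, - complex_of_real a#})
        \<longrightarrow> \<not> irreducibly_realizable \<sigma>) \<and>
     (sum_mset \<sigma> = 0 \<longrightarrow> (irreducibly_realizable \<sigma> \<longleftrightarrow> realizable \<sigma>))"
proof (intro conjI impI)
  assume "\<not> (\<exists>a b :: real. a > b \<and> b > 0 \<and>
            \<sigma> = {#complex_of_real a, complex_of_real b, - complex_of_real a#})"
  then show "irreducibly_realizable \<sigma> \<longleftrightarrow> realizable \<sigma>"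
    using realizable_imp_irreducibly_realizable_3[OF assms] irreducibly_realizable_imp_realizable
    by blast
next
  assume "\<exists>a b :: real. a > b \<and> b > 0 \<and>
            \<sigma> = {#complex_of_real a, complex_of_real b, - complex_of_real a#}"
  then show "\<not> irreducibly_realizable \<sigma>"
    using not_irreducibly_realizable_imprimitive by blast
next
  assume sum: "sum_mset \<sigma> = 0"
  \<comment> \<open>An exceptional list has sum \<open>b > 0\<close>.\<close>
  have "\<not> (\<exists>a b :: real. a > b \<and> b > 0 \<and>
            \<sigma> = {#complex_of_real a, complex_of_real b, - complex_of_real a#})"
    using sum by auto
  then show "irreducibly_realizable \<sigma> \<longleftrightarrow> realizable \<sigma>"
    using realizable_imp_irreducibly_realizable_3[OF assms] irreducibly_realizable_imp_realizable
    by blast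
qed

end
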